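(* Let $n_s\ge 1$ be an integer, let $\Omega_\zeta:=\{0,1\}^{n_s}$ and $\Omega_\theta:=[0,1]^{n_s}$, let $\mathcal{J}:\Omega_\zeta\to\mathbb{R}$, and let $\Upsilon:\Omega_\theta\to\mathbb{R}$ be $\Upsilon(\theta):=\mathbb{E}_{\zeta\sim\mathbb{P}(\zeta|\theta)}[\mathcal{J}(\zeta)]=\sum_{\zeta\in\Omega_\zeta}\mathcal{J}(\zeta)\,\mathbb{P}(\zeta|\theta)$, where $\mathbb{P}(\cdot|\theta)$ is the multivariate Bernoulli probability mass function with parameter $\theta$. Then $$\operatorname*{arg\,min}_{\zeta\in\Omega_\zeta}\mathcal{J}(\zeta)\ \subseteq\ \operatorname*{arg\,min}_{\theta\in\Omega_\theta}\Upsilon(\theta).$$ Moreover, if the minimizer $\zeta^{\mathrm{opt}}$ of $\mathcal{J}$ over $\Omega_\zeta$ is unique, then $\Upsilon$ has a unique minimizer $\theta^{\mathrm{opt}}$ over $\Omega_\theta$, and $\theta^{\mathrm{opt}}=\zeta^{\mathrm{opt}}$.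
   Context: The multivariate Bernoulli distribution with parameter $\theta=(\theta_1,\dots,\theta_{n_s})\in[0,1]^{n_s}$ is the law of $\zeta=(\zeta_1,\dots,\zeta_{n_s})\in\{0,1\}^{n_s}$ with independent components, $\zeta_i=1$ with probability $\theta_i$ and $\zeta_i=0$ with probability $1-\theta_i$. Its probability mass function is $$\mathbb{P}(\zeta|\theta)=\prod_{i=1}^{n_s}\theta_i^{\zeta_i}(1-\theta_i)^{1-\zeta_i}=\prod_{i=1}^{n_s}\big(\theta_i\zeta_i+(1-\theta_i)(1-\zeta_i)\big)$$ (with $0^0=1$). Here $\operatorname{arg\,min}$ denotes the set of all minimizers, and $\{0,1\}^{n_s}$ is regarded as a subset of $[0,1]^{n_s}$. In the paper, $\mathcal{J}=\Psi+\alpha\Phi$ is a regularized optimal-experimental-design criterion with user-chosen $\Psi$, $\Phi$, $\alpha$, so $\mathcal{J}$ is an arbitrary real-valued function on $\{0,1\}^{n_s}$. *)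

theory Defs
  imports "HOL-Probability.Probability"
begin

definition argmin_on :: "('a \<Rightarrow> real) \<Rightarrow> 'a set \<Rightarrow> 'a set" where
  "argmin_on f S = {x. is_arg_min f (\<lambda>y. y \<in> S) x}"

text \<open>The dimension is the cardinality of the finite, nonempty index type. Binary vectors are
  real vectors, so the binary domain is literally a subset of the unit cube.\<close>

definition Omega_zeta :: "(real ^ 'n) set" where
  "Omega_zeta = {z. \<forall>i. z $ i \<in> {0, 1}}"

definition Omega_theta :: "(real ^ 'n) set" where
  "Omega_theta = {t. \<forall>i. t $ i \<in> {0..1}}"

text \<open>The library clamps the parameter of \<open>bernoulli_pmf\<close> to the unit interval, so the
  following law is meaningful only for parameters in \<open>Omega_theta\<close>. The components are
  independent by the product construction \<open>Pi_pmf\<close>.\<close>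

definition mv_bernoulli :: "real ^ 'n \<Rightarrow> (real ^ 'n) pmf" where
  "mv_bernoulli \<theta> =
     map_pmf vec_lambda (Pi_pmf UNIV 0 (\<lambda>i. map_pmf of_bool (bernoulli_pmf (\<theta> $ i))))"

definition Upsilon :: "(real ^ 'n \<Rightarrow> real) \<Rightarrow> real ^ 'n \<Rightarrow> real" where
  "Upsilon J \<theta> = measure_pmf.expectation (mv_bernoulli \<theta>) J"

lemma pmf_of_bool_bernoulli:
  assumes "p \<in> {0..1}" "x \<in> {0, 1::real}"
  shows "pmf (map_pmf of_bool (bernoulli_pmf p)) x = p * x + (1 - p) * (1 - x)"
proof -
  have inj: "inj (of_bool :: bool \<Rightarrow> real)" by (auto simp: inj_def)
  have "pmf (map_pmf of_bool (bernoulli_pmf p)) (of_bool b :: real) = pmf (bernoulli_pmf p) b" for b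
    by (rule pmf_map_inj'[OF inj])
  from this[of True] this[of False] show ?thesis using assms by auto
qed

lemma pmf_mv_bernoulli_Pi:
  "pmf (mv_bernoulli \<theta>) z = (\<Prod>i\<in>UNIV. pmf (map_pmf of_bool (bernoulli_pmf (\<theta> $ i))) (z $ i))"
proof -
  have inj: "inj (vec_lambda :: ('n \<Rightarrow> real) \<Rightarrow> real ^ 'n)"
    by (auto simp: inj_def vec_lambda_inject)
  have "pmf (mv_bernoulli \<theta>) (vec_lambda (vec_nth z)) =
      pmf (Pi_pmf UNIV 0 (\<lambda>i. map_pmf of_bool (bernoulli_pmf (\<theta> $ i)))) (vec_nth z)"
    unfolding mv_bernoulli_def by (rule pmf_map_inj'[OF inj])
  then show ?thesis by (simp add: pmf_Pi)
qed

lemma pmf_mv_bernoulli: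
  assumes "\<theta> \<in> Omega_theta" "z \<in> Omega_zeta"
  shows "pmf (mv_bernoulli \<theta>) z = (\<Prod>i\<in>UNIV. \<theta> $ i * z $ i + (1 - \<theta> $ i) * (1 - z $ i))"
  unfolding pmf_mv_bernoulli_Pi using assms
  by (intro prod.cong pmf_of_bool_bernoulli) (auto simp: Omega_theta_def Omega_zeta_def)

text \<open>The exponents are natural numbers because \<open>0 powr 0 = 0\<close>, whereas \<open>0 ^ 0 = 1\<close>.\<close>

lemma pmf_mv_bernoulli_power:
  assumes "\<theta> \<in> Omega_theta" "z \<in> Omega_zeta"
  shows "pmf (mv_bernoulli \<theta>) z =
    (\<Prod>i\<in>UNIV. (\<theta> $ i) ^ nat \<lfloor>z $ i\<rfloor> * (1 - \<theta> $ i) ^ (1 - nat \<lfloor>z $ i\<rfloor>))"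
  unfolding pmf_mv_bernoulli[OF assms]
proof (rule prod.cong[OF refl])
  fix i
  have "z $ i = 0 \<or> z $ i = 1" using assms(2) by (auto simp: Omega_zeta_def)
  then show "\<theta> $ i * z $ i + (1 - \<theta> $ i) * (1 - z $ i) =
      (\<theta> $ i) ^ nat \<lfloor>z $ i\<rfloor> * (1 - \<theta> $ i) ^ (1 - nat \<lfloor>z $ i\<rfloor>)"
    by auto
qed

lemma finite_Omega_zeta: "finite (Omega_zeta :: (real ^ 'n) set)"
proof -
  have "finite (vec_lambda ` (UNIV \<rightarrow>\<^sub>E {0, 1::real}) :: (real ^ 'n) set)"
    by (intro finite_imageI finite_PiE) auto
  moreover have "(Omega_zeta :: (real ^ 'n) set) \<subseteq> vec_lambda ` (UNIV \<rightarrow>\<^sub>E {0, 1})"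
  proof
    fix z :: "real ^ 'n" assume "z \<in> Omega_zeta"
    then have "vec_nth z \<in> UNIV \<rightarrow>\<^sub>E {0, 1}" by (auto simp: Omega_zeta_def)
    moreover have "z = vec_lambda (vec_nth z)" by simp
    ultimately show "z \<in> vec_lambda ` (UNIV \<rightarrow>\<^sub>E {0, 1})" by (metis imageI)
  qed
  ultimately show ?thesis by (rule finite_subset[rotated])
qed

lemma set_pmf_mv_bernoulli: "set_pmf (mv_bernoulli \<theta>) \<subseteq> Omega_zeta"
proof
  fix z assume "z \<in> set_pmf (mv_bernoulli \<theta>)"
  then have "pmf (map_pmf of_bool (bernoulli_pmf (\<theta> $ i))) (z $ i) \<noteq> 0" for i
    by (auto simp: set_pmf_iff pmf_mv_bernoulli_Pi)
  then have "z $ i \<in> of_bool ` set_pmf (bernoulli_pmf (\<theta> $ i))" for i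
    by (metis set_map_pmf set_pmf_iff)
  then have "z $ i \<in> {0, 1}" for i by (metis imageE insertCI of_bool_def)
  then show "z \<in> Omega_zeta" by (simp add: Omega_zeta_def)
qed

lemma Upsilon_eq_sum:
  "Upsilon J \<theta> = (\<Sum>z\<in>Omega_zeta. J z * pmf (mv_bernoulli \<theta>) z)"
  unfolding Upsilon_def
  by (subst integral_measure_pmf_real[OF finite_Omega_zeta])
     (use set_pmf_mv_bernoulli in \<open>auto\<close>)

end

theory Submission
  imports Defs
begin

text \<open>Averaging cannot go below the minimum: \<open>Upsilon J \<theta>\<close> is a mean of the values of \<open>J\<close> on
  \<open>Omega_zeta\<close>, so it is at least the minimum \<open>m\<close> of \<open>J\<close> there
  (\<open>expectation_pmf_lower_bound\<close>). At a binary parameter the law is a point mass, so \<open>Upsilon J\<close>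
  extends \<open>J\<close> from the vertices to the cube (\<open>Upsilon_vertex\<close>) and \<open>m\<close> is attained at every
  minimizer of \<open>J\<close>. This gives the inclusion.

  For uniqueness, a mean equals the lower bound \<open>m\<close> only if the law is supported where
  \<open>J = m\<close> (\<open>expectation_pmf_eq_lower_bound\<close>). If \<open>J\<close> has a single minimizer, every minimizing law
  is therefore the point mass there, and since the mean vector of a multivariate Bernoulli law is
  its parameter (\<open>mean_mv_bernoulli\<close>), the parameter is that vertex.\<close>

lemma expectation_pmf_lower_bound:
  fixes f :: "'a \<Rightarrow> real"
  assumes "finite (set_pmf p)" "\<And>x. x \<in> set_pmf p \<Longrightarrow> m \<le> f x"
  shows "m \<le> measure_pmf.expectation p f"
  by (rule measure_pmf.integral_ge_const)
     (use assms in \<open>auto simp: AE_measure_pmf_iff intro: integrable_measure_pmf_finite\<close>)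

text \<open>The excess \<open>f x - m\<close> is nonnegative with mean zero, hence zero almost surely; for a
  discrete law this means zero at every point of the support.\<close>

lemma expectation_pmf_eq_lower_bound:
  fixes f :: "'a \<Rightarrow> real"
  assumes fin: "finite (set_pmf p)" and lb: "\<And>x. x \<in> set_pmf p \<Longrightarrow> m \<le> f x"
    and eq: "measure_pmf.expectation p f = m" and x: "x \<in> set_pmf p"
  shows "f x = m"
proof -
  have int: "integrable (measure_pmf p) g" for g :: "'a \<Rightarrow> real"
    using fin by (rule integrable_measure_pmf_finite)
  have "measure_pmf.expectation p (\<lambda>x. f x - m) = 0"
    using eq by (simp add: int)
  then have "AE x in measure_pmf p. f x - m = 0"
    by (subst (asm) integral_nonneg_eq_0_iff_AE[OF int]) (auto simp: AE_measure_pmf_iff lb)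
  with x show ?thesis
    by (simp add: AE_measure_pmf_iff)
qed

lemma finite_set_pmf_mv_bernoulli: "finite (set_pmf (mv_bernoulli \<theta>))"
  using set_pmf_mv_bernoulli finite_Omega_zeta by (rule finite_subset)

lemma Omega_zeta_subset_Omega_theta: "Omega_zeta \<subseteq> Omega_theta"
proof
  fix z :: "real ^ 'n" assume "z \<in> Omega_zeta"
  then have "z $ i = 0 \<or> z $ i = 1" for i by (auto simp: Omega_zeta_def)
  then have "0 \<le> z $ i \<and> z $ i \<le> 1" for i by (metis order_refl zero_le_one)
  then show "z \<in> Omega_theta" by (simp add: Omega_theta_def)
qed

lemma mv_bernoulli_vertex:
  assumes "z \<in> Omega_zeta"
  shows "mv_bernoulli z = return_pmf z"
proof -
  have bernoulli: "bernoulli_pmf (of_bool b) = return_pmf b" for b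
  proof (rule pmf_eqI)
    show "pmf (bernoulli_pmf (of_bool b)) c = pmf (return_pmf b) c" for c
      by (cases b; cases c) simp_all
  qed
  have "map_pmf of_bool (bernoulli_pmf (z $ i)) = return_pmf (z $ i)" for i
  proof -
    have "z $ i = 0 \<or> z $ i = 1" using assms by (auto simp: Omega_zeta_def)
    then show ?thesis
    proof
      assume "z $ i = 0"
      then show ?thesis using bernoulli[of False] by simp
    next
      assume "z $ i = 1"
      then show ?thesis using bernoulli[of True] by simp
    qed
  qed
  then show ?thesis
    by (simp add: mv_bernoulli_def Pi_pmf_return_pmf)
qed

lemma Upsilon_vertex: "z \<in> Omega_zeta \<Longrightarrow> Upsilon J z = J z"
  by (simp add: Upsilon_def mv_bernoulli_vertex)

text \<open>Only the marginal of coordinate \<open>i\<close> matters, and by the product construction it is the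
  Bernoulli law with parameter \<open>\<theta> $ i\<close>.\<close>

lemma mean_mv_bernoulli:
  assumes "\<theta> \<in> Omega_theta"
  shows "measure_pmf.expectation (mv_bernoulli \<theta>) (\<lambda>z. z $ i) = \<theta> $ i"
proof -
  have p: "0 \<le> \<theta> $ i" "\<theta> $ i \<le> 1" using assms by (auto simp: Omega_theta_def)
  have "map_pmf (\<lambda>z. z $ i) (mv_bernoulli \<theta>) =
      map_pmf (\<lambda>f. f i) (Pi_pmf UNIV 0 (\<lambda>i. map_pmf of_bool (bernoulli_pmf (\<theta> $ i))))"
    by (simp add: mv_bernoulli_def pmf.map_comp o_def)
  also have "\<dots> = map_pmf of_bool (bernoulli_pmf (\<theta> $ i))"
    by (simp add: Pi_pmf_component)
  finally have marginal:
    "map_pmf (\<lambda>z. z $ i) (mv_bernoulli \<theta>) = map_pmf of_bool (bernoulli_pmf (\<theta> $ i))" .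
  have "measure_pmf.expectation (mv_bernoulli \<theta>) (\<lambda>z. z $ i) =
      measure_pmf.expectation (map_pmf (\<lambda>z. z $ i) (mv_bernoulli \<theta>)) (\<lambda>x. x)"
    by simp
  also have "\<dots> = \<theta> $ i"
    unfolding marginal using p by simp
  finally show ?thesis .
qed

lemma mv_bernoulli_eq_return_pmfD:
  assumes "\<theta> \<in> Omega_theta" "mv_bernoulli \<theta> = return_pmf z"
  shows "\<theta> = z"
  using mean_mv_bernoulli[OF assms(1)] by (simp add: assms(2) vec_eq_iff)

lemma argmin_on_iff: "x \<in> argmin_on f S \<longleftrightarrow> x \<in> S \<and> (\<forall>y\<in>S. f x \<le> f y)"
  by (auto simp: argmin_on_def is_arg_min_def not_less)

lemma Upsilon_lower_bound:
  assumes "\<And>z. z \<in> Omega_zeta \<Longrightarrow> m \<le> J z"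
  shows "m \<le> Upsilon J \<theta>"
  unfolding Upsilon_def using set_pmf_mv_bernoulli assms
  by (intro expectation_pmf_lower_bound finite_set_pmf_mv_bernoulli) blast

theorem lemma3p2:
  fixes J :: "real ^ 'n \<Rightarrow> real"
  shows "argmin_on J Omega_zeta \<subseteq> argmin_on (Upsilon J) Omega_theta
    \<and> (\<forall>\<zeta>opt. argmin_on J Omega_zeta = {\<zeta>opt} \<longrightarrow> argmin_on (Upsilon J) Omega_theta = {\<zeta>opt})"
proof (intro conjI allI impI)
  show sub: "argmin_on J Omega_zeta \<subseteq> argmin_on (Upsilon J) Omega_theta"
  proof
    fix z assume "z \<in> argmin_on J Omega_zeta"
    then have z: "z \<in> Omega_zeta" and min: "\<And>y. y \<in> Omega_zeta \<Longrightarrow> J z \<le> J y"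
      by (auto simp: argmin_on_iff)
    have "Upsilon J z \<le> Upsilon J \<theta>" for \<theta>
      unfolding Upsilon_vertex[OF z] by (rule Upsilon_lower_bound) (rule min)
    then show "z \<in> argmin_on (Upsilon J) Omega_theta"
      using subsetD[OF Omega_zeta_subset_Omega_theta z] by (simp add: argmin_on_iff)
  qed
  fix \<zeta>opt assume unique: "argmin_on J Omega_zeta = {\<zeta>opt}"
  then have "\<zeta>opt \<in> argmin_on J Omega_zeta" by simp
  then have opt: "\<zeta>opt \<in> Omega_zeta" and min: "\<And>y. y \<in> Omega_zeta \<Longrightarrow> J \<zeta>opt \<le> J y"
    by (auto simp: argmin_on_iff)
  have "\<theta> = \<zeta>opt" if "\<theta> \<in> argmin_on (Upsilon J) Omega_theta" for \<theta>
  proof -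
    have \<theta>: "\<theta> \<in> Omega_theta" and "Upsilon J \<theta> \<le> Upsilon J \<zeta>opt"
      using that opt Omega_zeta_subset_Omega_theta by (auto simp: argmin_on_iff)
    moreover have "J \<zeta>opt \<le> Upsilon J \<theta>"
      by (rule Upsilon_lower_bound) (rule min)
    ultimately have eq: "Upsilon J \<theta> = J \<zeta>opt"
      by (simp add: Upsilon_vertex[OF opt])
    have "z = \<zeta>opt" if z: "z \<in> set_pmf (mv_bernoulli \<theta>)" for z
    proof -
      have "J z = J \<zeta>opt"
        by (rule expectation_pmf_eq_lower_bound[OF finite_set_pmf_mv_bernoulli _ _ z])
           (use min set_pmf_mv_bernoulli eq in \<open>auto simp: Upsilon_def\<close>)
      then have "z \<in> argmin_on J Omega_zeta"
        using z set_pmf_mv_bernoulli min by (auto simp: argmin_on_iff)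
      then show ?thesis by (simp add: unique)
    qed
    then have "set_pmf (mv_bernoulli \<theta>) \<subseteq> {\<zeta>opt}" by blast
    then have "mv_bernoulli \<theta> = return_pmf \<zeta>opt"
      by (simp add: set_pmf_subset_singleton)
    with \<theta> show ?thesis by (rule mv_bernoulli_eq_return_pmfD)
  qed
  then show "argmin_on (Upsilon J) Omega_theta = {\<zeta>opt}"
    using sub unfolding unique by blast
qed

end
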